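(* Let $n>3$. For Wolfram rule $73$ on the circular graph with $n$ vertices, the set of periodic states is $P_{73}=N_C$, and the number of orbits of the dynamics group $G_{73}$ on $P_{73}$ is $o_{73}=|N_{CD}|$.
   Context: Indices are taken modulo $n$. For $1\le i\le n$, the local update function $F_i\colon\mathbb{F}_2^n\to\mathbb{F}_2^n$ of Wolfram rule $73$ changes $y_i$ to $1-y_i$ if $y_{i-1}=y_{i+1}=0$, sets $y_i$ to $0$ if $y_{i-1}=y_{i+1}=1$, and otherwise leaves $\mathbf{y}$ unchanged; only the $i$-th coordinate can change. Rule $73$ is $\pi$-independent: for a simple update order $\pi$ (a sequence $\pi_1,\dots,\pi_n$ containing each of $1,\dots,n$ exactly once) the set of states periodic under iteration of $F_{\pi_n}\circ\cdots\circ F_{\pi_1}$ does not depend on $\pi$; this set is $P_{73}$. The dynamics group $G_{73}$ is the group of permutations of $P_{73}$ generated by the restrictions of $F_1,\dots,F_n$ to $P_{73}$. $N_C$ is the set of states in $\mathbb{F}_2^n$ not containing the (cyclic, contiguous) subword `111', and $N_{CD}$ is the set of states containing neither `111' nor `010' as a cyclic contiguous subword. *)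

theory Defs
  imports "HOL-Library.Z2" "HOL-Algebra.Group_Action" "HOL-Algebra.Generated_Groups"
begin

text \<open>A state in \<open>\<bbbF>\<^sub>2\<^sup>n\<close> is a list of length \<open>n\<close> over the field \<^typ>\<open>bit\<close>.  The vertices of the
  circular graph are the residues \<open>0, \<dots>, n - 1\<close>, where \<open>0\<close> stands for vertex \<open>n\<close>.\<close>

definition states :: "nat \<Rightarrow> bit list set" where
  "states n = {y. length y = n}"

text \<open>The left neighbour of \<open>i\<close> is written \<open>(i + n - 1) mod n\<close> because subtraction on the
  natural numbers truncates.\<close>

definition F73 :: "nat \<Rightarrow> nat \<Rightarrow> bit list \<Rightarrow> bit list" where
  "F73 n i y =
     (if y ! ((i + n - 1) mod n) = 0 \<and> y ! ((i + 1) mod n) = 0 then y[i := 1 - y ! i]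
      else if y ! ((i + n - 1) mod n) = 1 \<and> y ! ((i + 1) mod n) = 1 then y[i := 0]
      else y)"

definition simple_update_order :: "nat \<Rightarrow> nat list \<Rightarrow> bool" where
  "simple_update_order n \<pi> \<longleftrightarrow> distinct \<pi> \<and> set \<pi> = {..<n}"

text \<open>The head of \<open>\<pi>\<close> is applied first.\<close>

definition sds_map :: "nat \<Rightarrow> nat list \<Rightarrow> bit list \<Rightarrow> bit list" where
  "sds_map n \<pi> = fold (F73 n) \<pi>"

text \<open>The periodic states and the notions derived from them carry the update order \<open>\<pi>\<close> as a
  parameter, so that independence of \<open>\<pi>\<close> is not built into the definitions.\<close>

definition P73 :: "nat \<Rightarrow> nat list \<Rightarrow> bit list set" where
  "P73 n \<pi> = {y \<in> states n. \<exists>k>0. (sds_map n \<pi> ^^ k) y = y}"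

definition G73 :: "nat \<Rightarrow> nat list \<Rightarrow> (bit list \<Rightarrow> bit list) monoid" where
  "G73 n \<pi> = (BijGroup (P73 n \<pi>))
     \<lparr>carrier := generate (BijGroup (P73 n \<pi>)) ((\<lambda>i. restrict (F73 n i) (P73 n \<pi>)) ` {..<n})\<rparr>"

definition o73 :: "nat \<Rightarrow> nat list \<Rightarrow> nat" where
  "o73 n \<pi> = card (orbits (G73 n \<pi>) (P73 n \<pi>) (\<lambda>g. g))"

definition cyclic_subword :: "bit list \<Rightarrow> bit list \<Rightarrow> bool" where
  "cyclic_subword w y \<longleftrightarrow>
     (\<exists>i<length y. \<forall>j<length w. y ! ((i + j) mod length y) = w ! j)"

definition N_C :: "nat \<Rightarrow> bit list set" where
  "N_C n = {y \<in> states n. \<not> cyclic_subword [1, 1, 1] y}"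

definition N_CD :: "nat \<Rightarrow> bit list set" where
  "N_CD n = {y \<in> states n. \<not> cyclic_subword [1, 1, 1] y \<and> \<not> cyclic_subword [0, 1, 0] y}"

end

theory Submission
  imports Defs
begin

text \<open>
  \<^bold>\<open>Periodic states.\<close>  An update never creates a factor \<open>111\<close>: a cell that becomes \<open>1\<close> has both
  neighbours \<open>0\<close>.  Moreover, updating a cell destroys any \<open>111\<close> centred at it.  Hence a single
  sweep over all the cells, in any order, ends in a state without \<open>111\<close>, and every periodic state,
  being the result of a sweep, is of this kind (\<open>sweep_in_N_C\<close>).  Conversely, on the states without
  \<open>111\<close> the second clause of the rule has no effect, so that \<open>F\<^sub>i\<close> toggles cell \<open>i\<close> when both its
  neighbours are \<open>0\<close> and is the identity otherwise.  It is therefore an involution of the finite set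
  \<open>N_C\<close> (\<open>F73_involution\<close>), a sweep is a permutation of it, and each of its points is periodic.

  \<^bold>\<open>Orbits.\<close>  On \<open>N_C\<close> the only possible moves create or erase an isolated \<open>1\<close>, that is, the
  centre of a factor \<open>010\<close>.  So the state obtained by erasing all the isolated \<open>1\<close>s is an invariant
  of the moves (\<open>erase_isolated_F73\<close>), and it is reached by erasing them one after the other
  (\<open>generated_erase_isolated\<close>).  Hence the orbits are exactly the fibres of this erasing map; since
  it maps \<open>N_C\<close> onto \<open>N_CD\<close> and fixes \<open>N_CD\<close> pointwise, there are as many orbits as elements of
  \<open>N_CD\<close>.
\<close>

section \<open>Neighbours and factors of length three\<close>

definition left :: "nat \<Rightarrow> nat \<Rightarrow> nat" where
  "left n i = (i + n - 1) mod n"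

definition right :: "nat \<Rightarrow> nat \<Rightarrow> nat" where
  "right n i = (i + 1) mod n"

definition centred :: "nat \<Rightarrow> bit list \<Rightarrow> bit \<Rightarrow> bit \<Rightarrow> bit \<Rightarrow> nat \<Rightarrow> bool" where
  "centred n y a b c j \<longleftrightarrow> y ! left n j = a \<and> y ! j = b \<and> y ! right n j = c"

lemma left_if: "i < n \<Longrightarrow> left n i = (if i = 0 then n - 1 else i - 1)"
  unfolding left_def by (cases i) auto

lemma right_if: "i < n \<Longrightarrow> right n i = (if i = n - 1 then 0 else i + 1)"
  unfolding right_def by (auto simp: mod_less)

lemma left_less: "i < n \<Longrightarrow> left n i < n"
  by (auto simp: left_if)

lemma right_less: "i < n \<Longrightarrow> right n i < n"
  by (auto simp: right_if)

lemma left_right: "i < n \<Longrightarrow> left n (right n i) = i"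
  using right_less[of i n] by (auto simp: left_if right_if)

lemma right_left: "i < n \<Longrightarrow> right n (left n i) = i"
  using left_less[of i n] by (auto simp: left_if right_if)

lemma left_neq: "i < n \<Longrightarrow> n > 1 \<Longrightarrow> left n i \<noteq> i"
  by (auto simp: left_if)

lemma right_neq: "i < n \<Longrightarrow> n > 1 \<Longrightarrow> right n i \<noteq> i"
  by (auto simp: right_if)

lemmas neighbours = left_less right_less left_right right_left left_neq right_neq

lemma left_eq_iff: "i < n \<Longrightarrow> j < n \<Longrightarrow> left n j = i \<longleftrightarrow> j = right n i"
  using left_right right_left by metis

lemma right_eq_iff: "i < n \<Longrightarrow> j < n \<Longrightarrow> right n j = i \<longleftrightarrow> j = left n i"
  using left_right right_left by metis

text \<open>An occurrence of a factor is indexed by its first cell; the updates are described from the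
  middle cell, which is the right neighbour of the first one.\<close>

lemma cyclic_subword_centred:
  assumes "length y = n"
  shows "cyclic_subword [a, b, c] y \<longleftrightarrow> (\<exists>j<n. centred n y a b c j)"
proof -
  have 0: "cyclic_subword [a, b, c] y \<longleftrightarrow> (\<exists>i<n. centred n y a b c (right n i))"
  proof -
    have "(\<forall>j<length [a, b, c]. y ! ((i + j) mod length y) = [a, b, c] ! j)
          \<longleftrightarrow> centred n y a b c (right n i)" if "i < n" for i
      using that left_right[OF that]
      by (auto simp: centred_def assms right_def less_Suc_eq numeral_3_eq_3 mod_Suc_eq)
    then show ?thesis
      unfolding cyclic_subword_def assms by blast
  qed
  show ?thesis
    unfolding 0 by (metis left_less right_less right_left)
qed

lemma N_C_iff: "y \<in> N_C n \<longleftrightarrow> length y = n \<and> (\<forall>j<n. \<not> centred n y 1 1 1 j)"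
  by (auto simp: N_C_def states_def cyclic_subword_centred)

lemma N_CD_iff: "y \<in> N_CD n \<longleftrightarrow> y \<in> N_C n \<and> (\<forall>j<n. \<not> centred n y 0 1 0 j)"
  by (auto simp: N_CD_def N_C_iff states_def cyclic_subword_centred)

lemma finite_N_C: "finite (N_C n)"
proof -
  have "finite (UNIV :: bit set)"
    by (rule finite_subset[of _ "{0, 1}"]) (auto simp: bit_not_zero_iff)
  then have "finite {y :: bit list. length y = n}"
    using finite_lists_length_eq[of "UNIV :: bit set" n] by simp
  then show ?thesis
    by (rule rev_finite_subset) (auto simp: N_C_def states_def)
qed

section \<open>Periodic states\<close>

lemma F73_eq:
  "F73 n i y =
     (if y ! left n i = 0 \<and> y ! right n i = 0 then y[i := 1 - y ! i]
      else if y ! left n i = 1 \<and> y ! right n i = 1 then y[i := 0] else y)"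
  by (simp add: F73_def left_def right_def)

lemma length_F73 [simp]: "length (F73 n i y) = length y"
  by (simp add: F73_eq)

lemma F73_nth_other: "j \<noteq> i \<Longrightarrow> F73 n i y ! j = y ! j"
  by (simp add: F73_eq)

text \<open>If a neighbour of \<open>j\<close> is updated while cell \<open>j\<close> carries a \<open>1\<close>, then it cannot turn into a
  \<open>1\<close>; if cell \<open>j\<close> itself is updated between two \<open>1\<close>s, then it becomes \<open>0\<close>.\<close>

lemma F73_no_new_111:
  assumes "n > 1" "length y = n" "i < n" "j < n" "centred n (F73 n i y) 1 1 1 j"
  shows "centred n y 1 1 1 j \<and> j \<noteq> i"
proof -
  have 1: "F73 n i y ! left n j = 1" "F73 n i y ! j = 1" "F73 n i y ! right n j = 1"
    using assms(5) by (auto simp: centred_def)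
  have ji: "j \<noteq> i"
  proof
    assume "j = i"
    with 1 assms neighbours[of i n] have "y ! left n i = 1" "y ! right n i = 1"
      by (auto simp: F73_nth_other)
    with 1 \<open>j = i\<close> assms show False
      by (simp add: F73_eq)
  qed
  then have yj: "y ! j = 1"
    using 1 by (simp add: F73_nth_other)
  have keep: "y ! i = 1" if "j = left n i \<or> j = right n i" "F73 n i y ! i = 1"
    using that yj assms by (auto simp: F73_eq split: if_splits)
  have "y ! left n j = 1"
    using 1 keep assms right_left[of j n] by (metis F73_nth_other)
  moreover have "y ! right n j = 1"
    using 1 keep assms left_right[of j n] by (metis F73_nth_other)
  ultimately show ?thesis
    using yj ji by (simp add: centred_def)
qed

lemma sweep_no_111:
  assumes "n > 1" "length y = n" "set xs \<subseteq> {..<n}" "j < n"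
    and "centred n (fold (F73 n) xs y) 1 1 1 j"
  shows "centred n y 1 1 1 j \<and> j \<notin> set xs"
  using assms
proof (induction xs arbitrary: y)
  case (Cons i xs)
  then have "centred n (F73 n i y) 1 1 1 j \<and> j \<notin> set xs"
    using Cons.IH[of "F73 n i y"] by simp
  with Cons.prems F73_no_new_111[of n y i j] show ?case
    by auto
qed simp

lemma length_sweep [simp]: "length (fold (F73 n) xs y) = length y"
  by (induction xs arbitrary: y) auto

lemma sweep_in_N_C:
  assumes "n > 1" "simple_update_order n \<pi>" "length y = n"
  shows "sds_map n \<pi> y \<in> N_C n"
  using sweep_no_111[of n y \<pi>] assms
  by (auto simp: N_C_iff sds_map_def simple_update_order_def)

lemma F73_on_N_C:
  assumes "y \<in> N_C n" "i < n"
  shows "F73 n i y = (if y ! left n i = 0 \<and> y ! right n i = 0 then y[i := 1 - y ! i] else y)"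
proof -
  have "y[i := 0] = y" if "y ! left n i = 1" "y ! right n i = 1"
  proof -
    have "y ! i = 0"
      using assms that by (auto simp: N_C_iff centred_def simp flip: bit_not_one_iff)
    then show ?thesis by (metis list_update_id)
  qed
  then show ?thesis by (auto simp: F73_eq)
qed

lemma F73_in_N_C:
  assumes "n > 1" "y \<in> N_C n" "i < n"
  shows "F73 n i y \<in> N_C n"
  using assms F73_no_new_111[of n y i] by (auto simp: N_C_iff)

lemma F73_involution:
  assumes "n > 1" "y \<in> N_C n" "i < n"
  shows "F73 n i (F73 n i y) = y"
proof (cases "y ! left n i = 0 \<and> y ! right n i = 0")
  case True
  have len: "length y = n"
    using assms by (simp add: N_C_iff)
  have F: "F73 n i y = y[i := 1 - y ! i]"
    using True by (simp add: F73_eq)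
  have "F73 n i y ! left n i = 0 \<and> F73 n i y ! right n i = 0"
    using True assms by (simp add: F73_nth_other neighbours)
  then have "F73 n i (F73 n i y) = (F73 n i y)[i := 1 - F73 n i y ! i]"
    unfolding F73_eq[of n i "F73 n i y"] by (rule if_P)
  also have "1 - F73 n i y ! i = y ! i"
    using F len assms(3) by (cases "y ! i = 0") auto
  also have "(F73 n i y)[i := y ! i] = y"
    by (simp only: F list_update_overwrite list_update_id)
  finally show ?thesis .
next
  case False
  then have "F73 n i y = y"
    using F73_on_N_C[OF assms(2,3)] by auto
  then show ?thesis
    by simp
qed

lemma sweep_inj_on_N_C:
  assumes "n > 1" "set xs \<subseteq> {..<n}"
  shows "inj_on (fold (F73 n) xs) (N_C n) \<and> fold (F73 n) xs ` N_C n \<subseteq> N_C n"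
  using assms
proof (induction xs)
  case (Cons i xs)
  have i: "i < n"
    using Cons.prems by simp
  have "inj_on (F73 n i) (N_C n)"
    using F73_involution[OF \<open>n > 1\<close> _ i] by (rule inj_on_inverseI)
  moreover have "F73 n i ` N_C n \<subseteq> N_C n"
    using F73_in_N_C[OF \<open>n > 1\<close> _ i] by auto
  moreover have IH: "inj_on (fold (F73 n) xs) (N_C n)" "fold (F73 n) xs ` N_C n \<subseteq> N_C n"
    using Cons by auto
  ultimately have "inj_on (fold (F73 n) xs \<circ> F73 n i) (N_C n)"
    by (meson comp_inj_on inj_on_subset)
  moreover have "(fold (F73 n) xs \<circ> F73 n i) ` N_C n \<subseteq> N_C n"
    using IH(2) \<open>F73 n i ` N_C n \<subseteq> N_C n\<close> by fastforce
  ultimately show ?case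
    by (simp only: fold_Cons)
qed simp

lemma inj_on_finite_periodic:
  assumes "finite S" "inj_on f S" "f ` S \<subseteq> S" "x \<in> S"
  shows "\<exists>k>0. (f ^^ k) x = x"
proof -
  define g where "g = (\<lambda>z. if z \<in> S then f z else z)"
  have "inj g"
    using assms(2,3) unfolding g_def inj_def inj_on_def by (auto simp: image_subset_iff)
  have g: "(g ^^ k) x = (f ^^ k) x \<and> (g ^^ k) x \<in> S" for k
    using assms(3,4) by (induction k) (auto simp: g_def)
  then have "{z. \<exists>k. z = (g ^^ k) x} \<subseteq> S"
    by blast
  then have "finite {z. \<exists>k. z = (g ^^ k) x}"
    using assms(1) by (rule finite_subset)
  with \<open>inj g\<close> obtain k where "k > 0" "(g ^^ k) x = x"
    by (rule funpow_inj_finite)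
  then show ?thesis
    using g by metis
qed

lemma periodic_states:
  assumes "n > 1" "simple_update_order n \<pi>"
  shows "P73 n \<pi> = N_C n"
proof
  show "P73 n \<pi> \<subseteq> N_C n"
  proof
    fix y assume "y \<in> P73 n \<pi>"
    then obtain k where y: "length y = n" "k > 0" "(sds_map n \<pi> ^^ k) y = y"
      by (auto simp: P73_def states_def)
    then obtain m where "k = Suc m"
      using gr0_conv_Suc by auto
    then have "sds_map n \<pi> ((sds_map n \<pi> ^^ m) y) = y"
      using y by simp
    moreover have "length ((sds_map n \<pi> ^^ m) y) = n"
      by (induction m) (auto simp: y sds_map_def)
    ultimately show "y \<in> N_C n"
      using sweep_in_N_C[OF assms] by metis
  qed
  show "N_C n \<subseteq> P73 n \<pi>"
    using inj_on_finite_periodic[OF finite_N_C] sweep_inj_on_N_C[of n \<pi>] assms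
    by (auto simp: P73_def N_C_def states_def simple_update_order_def sds_map_def)
qed

section \<open>The group generated by the updates\<close>

lemma update_in_Bij:
  assumes "n > 1" "i < n"
  shows "restrict (F73 n i) (N_C n) \<in> Bij (N_C n)"
proof -
  have "bij_betw (F73 n i) (N_C n) (N_C n)"
    using F73_in_N_C F73_involution assms
    by (intro bij_betwI[where g = "F73 n i"]) auto
  then show ?thesis
    by (simp add: Bij_def)
qed

text \<open>As the generators are their own inverses, an invariance under the updates passes to the
  whole group.\<close>

lemma inv_update:
  assumes "n > 1" "i < n"
  shows "inv\<^bsub>BijGroup (N_C n)\<^esub> (restrict (F73 n i) (N_C n)) = restrict (F73 n i) (N_C n)"
proof -
  let ?f = "restrict (F73 n i) (N_C n)"
  have "compose (N_C n) ?f ?f = (\<lambda>y\<in>N_C n. y)"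
    using F73_in_N_C F73_involution assms by (auto simp: compose_def fun_eq_iff)
  then show ?thesis
    using update_in_Bij[OF assms]
    by (intro group.inv_equality[OF group_BijGroup]) (simp_all add: BijGroup_def)
qed

definition updates :: "nat \<Rightarrow> (bit list \<Rightarrow> bit list) set" where
  "updates n = (\<lambda>i. restrict (F73 n i) (N_C n)) ` {..<n}"

text \<open>This is the dynamics group with the set of periodic states already identified, so that the
  update order no longer occurs.\<close>

definition generated :: "nat \<Rightarrow> (bit list \<Rightarrow> bit list) monoid" where
  "generated n = (BijGroup (N_C n)) \<lparr>carrier := generate (BijGroup (N_C n)) (updates n)\<rparr>"

lemma updates_subset: "n > 1 \<Longrightarrow> updates n \<subseteq> carrier (BijGroup (N_C n))"
  using update_in_Bij by (auto simp: updates_def BijGroup_def)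

lemma generated_action:
  assumes "n > 1"
  shows "group_action (generated n) (N_C n) (\<lambda>g. g)"
proof -
  have sub: "subgroup (generate (BijGroup (N_C n)) (updates n)) (BijGroup (N_C n))"
    using group.generate_is_subgroup[OF group_BijGroup updates_subset[OF assms]] .
  then have "group (generated n)"
    unfolding generated_def by (rule subgroup.subgroup_is_group[OF _ group_BijGroup])
  moreover have "(\<lambda>g. g) \<in> hom (generated n) (BijGroup (N_C n))"
    using subgroup.subset[OF sub] by (auto simp: hom_def generated_def)
  ultimately show ?thesis
    by (intro group_action.intro group_hom.intro group_hom_axioms.intro group_BijGroup)
qed

section \<open>Erasing the isolated ones, and the number of orbits\<close>

definition erase_isolated :: "nat \<Rightarrow> bit list \<Rightarrow> bit list" where
  "erase_isolated n y =
     map (\<lambda>j. if y ! left n j = 0 \<and> y ! right n j = 0 then 0 else y ! j) [0..<n]"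

lemma length_erase_isolated [simp]: "length (erase_isolated n y) = n"
  by (simp add: erase_isolated_def)

lemma erase_isolated_nth:
  "j < n \<Longrightarrow> erase_isolated n y ! j
     = (if y ! left n j = 0 \<and> y ! right n j = 0 then 0 else y ! j)"
  by (simp add: erase_isolated_def)

lemma erase_isolated_fixed:
  assumes "y \<in> N_C n" "\<forall>j<n. \<not> centred n y 0 1 0 j"
  shows "erase_isolated n y = y"
proof (rule nth_equalityI)
  show "length (erase_isolated n y) = length y"
    using assms by (simp add: N_C_iff)
next
  fix j assume "j < length (erase_isolated n y)"
  then show "erase_isolated n y ! j = y ! j"
    using assms(2) by (auto simp: erase_isolated_nth centred_def)
qed

text \<open>The erasing does not produce new isolated \<open>1\<close>s: a surviving \<open>1\<close> has a neighbouring \<open>1\<close>, and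
  this one survives as well.\<close>

lemma erase_isolated_in_N_CD:
  assumes "y \<in> N_C n"
  shows "erase_isolated n y \<in> N_CD n"
proof -
  let ?z = "erase_isolated n y"
  have one: "y ! j = 1 \<and> (y ! left n j = 1 \<or> y ! right n j = 1)" if "j < n" "?z ! j = 1" for j
    using that by (auto simp: erase_isolated_nth split: if_splits)
  have 111: "\<not> centred n ?z 1 1 1 j" if "j < n" for j
  proof
    assume "centred n ?z 1 1 1 j"
    then have "centred n y 1 1 1 j"
      using one that neighbours(1,2)[OF that] by (metis centred_def)
    then show False
      using assms that by (simp add: N_C_iff)
  qed
  have 010: "\<not> centred n ?z 0 1 0 j" if j: "j < n" for j
  proof
    assume z: "centred n ?z 0 1 0 j"
    then have "y ! j = 1" "y ! left n j = 1 \<or> y ! right n j = 1"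
      using one[OF j] by (auto simp: centred_def)
    then have "?z ! left n j = 1 \<or> ?z ! right n j = 1"
      using j by (auto simp: erase_isolated_nth neighbours)
    with z show False
      by (auto simp: centred_def)
  qed
  show ?thesis
    using 111 010 by (simp add: N_CD_iff N_C_iff)
qed

text \<open>Only a cell \<open>i\<close> with both neighbours \<open>0\<close> can change.  Its erased value is \<open>0\<close> before and
  after, and so are those of its neighbours; no other cell sees it.\<close>

lemma erase_isolated_F73:
  assumes "n > 1" "y \<in> N_C n" "i < n"
  shows "erase_isolated n (F73 n i y) = erase_isolated n y"
proof (cases "y ! left n i = 0 \<and> y ! right n i = 0")
  case True
  show ?thesis
  proof (rule nth_equalityI)
    fix j assume "j < length (erase_isolated n (F73 n i y))"
    then have j: "j < n"
      by simp
    have nb: "F73 n i y ! left n i = 0" "F73 n i y ! right n i = 0"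
      using True assms by (simp_all add: F73_nth_other neighbours)
    consider "j = i" | "j = left n i" "j \<noteq> i" | "j = right n i" "j \<noteq> i"
      | "j \<noteq> i" "left n j \<noteq> i" "right n j \<noteq> i"
      using assms(3) j left_eq_iff right_eq_iff by metis
    then show "erase_isolated n (F73 n i y) ! j = erase_isolated n y ! j"
      by cases (use True nb j in \<open>simp_all add: erase_isolated_nth F73_nth_other\<close>)
  qed simp
next
  case False
  then show ?thesis
    using F73_on_N_C[OF assms(2,3)] by auto
qed

lemma erase_isolated_generated:
  assumes "n > 1" "g \<in> carrier (generated n)" "y \<in> N_C n"
  shows "g y \<in> N_C n \<and> erase_isolated n (g y) = erase_isolated n y"
proof -
  have gen: "g \<in> generate (BijGroup (N_C n)) (updates n)"
    using assms(2) by (simp add: generated_def)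
  then show ?thesis
    using assms(3)
  proof (induction g arbitrary: y rule: generate.induct)
    case one
    then show ?case
      by (simp add: BijGroup_def)
  next
    case (incl h)
    then show ?case
      using F73_in_N_C[OF assms(1)] erase_isolated_F73[OF assms(1)] by (auto simp: updates_def)
  next
    case (inv h)
    then show ?case
      using F73_in_N_C[OF assms(1)] erase_isolated_F73[OF assms(1)]
      by (auto simp: updates_def inv_update[OF assms(1)])
  next
    case (eng g h)
    have "generate (BijGroup (N_C n)) (updates n) \<subseteq> Bij (N_C n)"
      using group.generate_incl[OF group_BijGroup updates_subset[OF assms(1)]]
      by (simp only: BijGroup_def partial_object.select_convs)
    then have "g \<in> Bij (N_C n)" "h \<in> Bij (N_C n)"
      using eng.hyps(1,2) by blast+
    then have "(g \<otimes>\<^bsub>BijGroup (N_C n)\<^esub> h) y = g (h y)"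
      using eng.prems by (simp add: BijGroup_def compose_def)
    with eng show ?case
      by metis
  qed
qed

text \<open>Updating an isolated \<open>1\<close> erases it, so the number of \<open>1\<close>s decreases until none is isolated.\<close>

lemma generated_erase_isolated:
  assumes "n > 1" "y \<in> N_C n"
  shows "erase_isolated n y \<in> orbit (generated n) (\<lambda>g. g) y"
  using assms(2)
proof (induction "card {j. j < n \<and> y ! j = 1}" arbitrary: y rule: less_induct)
  case less
  interpret group_action "generated n" "N_C n" "\<lambda>g. g"
    by (rule generated_action[OF assms(1)])
  show ?case
  proof (cases "\<forall>j<n. \<not> centred n y 0 1 0 j")
    case True
    then show ?thesis
      using erase_isolated_fixed[OF less.prems] orbit_refl[OF less.prems] by simp
  next
    case False
    then obtain i where i: "i < n" "y ! left n i = 0" "y ! i = 1" "y ! right n i = 0"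
      by (auto simp: centred_def)
    let ?z = "F73 n i y"
    have z: "?z \<in> N_C n"
      using F73_in_N_C[OF assms(1) less.prems i(1)] .
    have "?z = y[i := 0]"
      using i by (simp add: F73_eq)
    then have "?z ! i = 0"
      using i less.prems by (simp add: N_C_iff)
    then have "{j. j < n \<and> ?z ! j = 1} \<subseteq> {j. j < n \<and> y ! j = 1} - {i}"
      by (auto simp: F73_nth_other) (metis F73_nth_other zero_neq_one)
    then have "{j. j < n \<and> ?z ! j = 1} \<subset> {j. j < n \<and> y ! j = 1}"
      using i by auto
    then have "card {j. j < n \<and> ?z ! j = 1} < card {j. j < n \<and> y ! j = 1}"
      by (intro psubset_card_mono) auto
    then have 1: "erase_isolated n y \<in> orbit (generated n) (\<lambda>g. g) ?z"
      using less.hyps[OF _ z] erase_isolated_F73[OF assms(1) less.prems i(1)] by simp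
    have "restrict (F73 n i) (N_C n) \<in> carrier (generated n)"
      using i(1) by (auto simp: generated_def updates_def intro: generate.incl)
    then have "restrict (F73 n i) (N_C n) y \<in> orbit (generated n) (\<lambda>g. g) y"
      unfolding orbit_def by (intro CollectI exI[of _ "restrict (F73 n i) (N_C n)"]) simp
    then have 2: "?z \<in> orbit (generated n) (\<lambda>g. g) y"
      using less.prems by simp
    have "erase_isolated n y \<in> N_C n"
      using erase_isolated_in_N_CD[OF less.prems] by (simp add: N_CD_iff)
    then show ?thesis
      using orbit_trans[OF less.prems z _ 2 1] by simp
  qed
qed

lemma orbit_generated:
  assumes "n > 1" "y \<in> N_C n"
  shows "orbit (generated n) (\<lambda>g. g) y = {x \<in> N_C n. erase_isolated n x = erase_isolated n y}"
proof
  show "orbit (generated n) (\<lambda>g. g) y \<subseteq> {x \<in> N_C n. erase_isolated n x = erase_isolated n y}"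
    using erase_isolated_generated[OF assms(1) _ assms(2)] by (auto simp: orbit_def)
next
  interpret group_action "generated n" "N_C n" "\<lambda>g. g"
    by (rule generated_action[OF assms(1)])
  show "{x \<in> N_C n. erase_isolated n x = erase_isolated n y} \<subseteq> orbit (generated n) (\<lambda>g. g) y"
  proof safe
    fix x assume x: "x \<in> N_C n" "erase_isolated n x = erase_isolated n y"
    let ?z = "erase_isolated n y"
    have z: "?z \<in> N_C n"
      using erase_isolated_in_N_CD[OF assms(2)] by (simp add: N_CD_iff)
    have "x \<in> orbit (generated n) (\<lambda>g. g) ?z"
      using generated_erase_isolated[OF assms(1) x(1)] x(2) orbit_sym[OF x(1) z] by simp
    then show "x \<in> orbit (generated n) (\<lambda>g. g) y"
      using orbit_trans[OF assms(2) z x(1) generated_erase_isolated[OF assms]] by simp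
  qed
qed

lemma card_orbits_generated:
  assumes "n > 1"
  shows "card (orbits (generated n) (N_C n) (\<lambda>g. g)) = card (N_CD n)"
proof -
  let ?fibre = "\<lambda>z. {x \<in> N_C n. erase_isolated n x = z}"
  have fixed: "z \<in> N_C n \<and> erase_isolated n z = z" if "z \<in> N_CD n" for z
    using that erase_isolated_fixed by (auto simp: N_CD_iff)
  have "orbits (generated n) (N_C n) (\<lambda>g. g) = ?fibre ` erase_isolated n ` N_C n"
    using orbit_generated[OF assms] by (auto simp: orbits_def image_def)
  also have "erase_isolated n ` N_C n = N_CD n"
    using erase_isolated_in_N_CD fixed by (force simp: image_def)
  also have "card (?fibre ` N_CD n) = card (N_CD n)"
  proof (intro card_image inj_onI)
    fix z z'
    assume "z \<in> N_CD n" "z' \<in> N_CD n" "?fibre z = ?fibre z'"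
    then have "z \<in> ?fibre z'"
      using fixed by blast
    then show "z = z'"
      using fixed[OF \<open>z \<in> N_CD n\<close>] by simp
  qed
  finally show ?thesis .
qed

theorem mainTheorem11:
  fixes n :: nat and \<pi> :: "nat list"
  assumes "n > 3"
    and "simple_update_order n \<pi>"
  shows "P73 n \<pi> = N_C n \<and> o73 n \<pi> = card (N_CD n)"
proof -
  have n: "n > 1"
    using assms(1) by simp
  have P: "P73 n \<pi> = N_C n"
    using periodic_states[OF n assms(2)] .
  then have "G73 n \<pi> = generated n"
    by (simp add: G73_def generated_def updates_def)
  then show ?thesis
    using P card_orbits_generated[OF n] by (simp add: o73_def)
qed

end
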